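(* Let $H$ be an infinite-dimensional separable complex Hilbert space, let $\mathbb{X}$ be a topological space with at most countably many connected components, and let $n_c$ be the cardinality of the set $\mathbb{X}^c$ of connected components of $\mathbb{X}$. Let $\mathcal{T}:\mathbb{X}\to Fred(H)$, $x\mapsto\mathcal{T}_x$, be a continuous family of Fredholm operators. Then the index $ind(\mathcal{T})=(ind(\mathcal{T}_x))_{\overline{x}\in\mathbb{X}^c}$ is well defined as an element of $\mathbb{Z}^{n_c}$ (that is, $ind(\mathcal{T}_x)$ depends only on the connected component $\overline{x}$ of $x$). In particular, if $\mathbb{X}$ is reduced to a single element, then the index of $\mathcal{T}$ is equal to the usual index of the single Fredholm operator $\mathcal{T}$.
   Context: $L(H)$ is the algebra of bounded linear operators on $H$. An operator $T\in L(H)$ is Fredholm if $n(T)=\dim N(T)$ and $d(T)=\mathrm{codim}\,R(T)$ are both finite, where $N(T)$ is the nullspace and $R(T)$ the range; its usual index is $ind(T)=n(T)-d(T)$. $Fred(H)$ is the set of Fredholm operators with the norm topology of $L(H)$. For $x\in\mathbb{X}$, $\overline{x}$ denotes the connected component of $x$, and $\mathbb{X}^c$ is the set of connected components. The index of a continuous family $\mathcal{T}:\mathbb{X}\to Fred(H)$ is $ind(\mathcal{T})=(ind(\mathcal{T}_x))_{\overline{x}\in\mathbb{X}^c}$. *)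

theory Defs
  imports "HOL-Analysis.Analysis"
begin

text \<open>
  Complex Hilbert spaces. The inner product is linear in its first argument; it is positive
  definite because it induces the norm of the underlying Banach space.
\<close>

class complex_hilbert_space = banach +
  fixes scaleC :: "complex \<Rightarrow> 'a \<Rightarrow> 'a"  (infixr \<open>*\<^sub>C\<close> 75)
    and cinner :: "'a \<Rightarrow> 'a \<Rightarrow> complex"
  assumes scaleC_add_right: "c *\<^sub>C (x + y) = c *\<^sub>C x + c *\<^sub>C y"
    and scaleC_add_left: "(c + d) *\<^sub>C x = c *\<^sub>C x + d *\<^sub>C x"
    and scaleC_scaleC: "c *\<^sub>C (d *\<^sub>C x) = (c * d) *\<^sub>C x"
    and scaleC_of_real: "complex_of_real r *\<^sub>C x = r *\<^sub>R x"
    and cinner_commute: "cinner x y = cnj (cinner y x)"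
    and cinner_add_left: "cinner (x + y) z = cinner x z + cinner y z"
    and cinner_scaleC_left: "cinner (c *\<^sub>C x) y = c * cinner x y"
    and cinner_nonneg: "0 \<le> Re (cinner x x)"
    and norm_eq_sqrt_cinner: "norm x = sqrt (Re (cinner x x))"

global_interpretation complex_vector:
  vector_space "scaleC :: complex \<Rightarrow> 'a \<Rightarrow> 'a :: complex_hilbert_space"
proof
  show "1 *\<^sub>C x = x" for x :: 'a
    using scaleC_of_real[of 1 x] by simp
qed (simp_all add: scaleC_add_right scaleC_add_left scaleC_scaleC)

text \<open>
  Finite-dimensionality over the complex numbers. It is needed next to the library's dimension,
  which is \<open>0\<close> for spaces without a finite basis.
\<close>

definition cfinite_dim :: "'a::complex_hilbert_space set \<Rightarrow> bool" where
  "cfinite_dim S \<longleftrightarrow> (\<exists>B. finite B \<and> complex_vector.span B = S)"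

text \<open>
  The operator norm of a complex linear operator does not depend on whether it is viewed as a
  complex or a real linear operator. The algebra \<open>L(H)\<close> is therefore taken to be this set of
  bounded real linear maps, with the norm topology of that type.
\<close>

definition bounded_clinear_ops :: "('a::complex_hilbert_space \<Rightarrow>\<^sub>L 'a) set" where
  "bounded_clinear_ops = {T. \<forall>c x. blinfun_apply T (c *\<^sub>C x) = c *\<^sub>C blinfun_apply T x}"

definition nullspace :: "('a::complex_hilbert_space \<Rightarrow>\<^sub>L 'a) \<Rightarrow> 'a set" where
  "nullspace T = {x. blinfun_apply T x = 0}"

text \<open>
  The algebraic quotient \<open>H/W\<close> by a linear subspace \<open>W\<close>, as the set of cosets of \<open>W\<close>.
\<close>

definition quotient_space :: "'a::complex_hilbert_space set \<Rightarrow> 'a set set" where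
  "quotient_space W = UNIV // {(x, y). x - y \<in> W}"

text \<open>
  The linear combination in \<open>H/W\<close> of a finite set \<open>X\<close> of cosets with coefficients \<open>u\<close>, computed
  on representatives \<open>s\<close>; the empty combination is \<open>W\<close>, the zero of \<open>H/W\<close>.
\<close>

definition quotient_lincomb ::
    "'a::complex_hilbert_space set \<Rightarrow> ('a set \<Rightarrow> complex) \<Rightarrow> 'a set set \<Rightarrow> 'a set" where
  "quotient_lincomb W u X = {y. \<exists>s. (\<forall>A\<in>X. s A \<in> A) \<and> (\<Sum>A\<in>X. u A *\<^sub>C s A) - y \<in> W}"

definition finite_quotient_basis :: "'a::complex_hilbert_space set \<Rightarrow> 'a set set \<Rightarrow> bool" where
  "finite_quotient_basis W X \<longleftrightarrow>
     finite X \<and> X \<subseteq> quotient_space W \<and>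
     (\<forall>u. quotient_lincomb W u X = W \<longrightarrow> (\<forall>A\<in>X. u A = 0)) \<and>
     (\<forall>A\<in>quotient_space W. \<exists>u. A = quotient_lincomb W u X)"

definition finite_codim :: "'a::complex_hilbert_space set \<Rightarrow> bool" where
  "finite_codim W \<longleftrightarrow> (\<exists>X. finite_quotient_basis W X)"

text \<open>The dimension of \<open>H/W\<close>; only meaningful if \<open>finite_codim W\<close>.\<close>

definition codim :: "'a::complex_hilbert_space set \<Rightarrow> nat" where
  "codim W = card (SOME X. finite_quotient_basis W X)"

definition Fred :: "('a::complex_hilbert_space \<Rightarrow>\<^sub>L 'a) set" where
  "Fred = {T \<in> bounded_clinear_ops.
     cfinite_dim (nullspace T) \<and> finite_codim (range (blinfun_apply T))}"

definition fredholm_index :: "('a::complex_hilbert_space \<Rightarrow>\<^sub>L 'a) \<Rightarrow> int" where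
  "fredholm_index T =
     int (complex_vector.dim (nullspace T)) - int (codim (range (blinfun_apply T)))"

text \<open>
  The index of a family is an element of \<open>\<int>\<close> to the power \<open>n\<^sub>c\<close>, written as an integer-valued
  function on the set of connected components. \<open>is_family_index X \<T> i\<close> says that
  \<open>i\<close> is the family \<open>(ind(\<T> x))\<close> indexed by the components of the points \<open>x\<close>; that such an \<open>i\<close> exists is
  exactly the well-definedness of the index.
\<close>

definition is_family_index ::
    "'x topology \<Rightarrow> ('x \<Rightarrow> 'a::complex_hilbert_space \<Rightarrow>\<^sub>L 'a) \<Rightarrow> ('x set \<Rightarrow> int) \<Rightarrow> bool" where
  "is_family_index X \<T> i \<longleftrightarrow>
     i \<in> connected_components_of X \<rightarrow>\<^sub>E (UNIV :: int set) \<and>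
     (\<forall>x\<in>topspace X. i (connected_component_of_set X x) = fredholm_index (\<T> x))"

definition family_index ::
    "'x topology \<Rightarrow> ('x \<Rightarrow> 'a::complex_hilbert_space \<Rightarrow>\<^sub>L 'a) \<Rightarrow> 'x set \<Rightarrow> int" where
  "family_index X \<T> = (THE i. is_family_index X \<T> i)"

end

theory Submission
  imports Defs
begin

text \<open>
  The index is locally constant on \<open>Fred\<close>, hence constant on the connected image of a component.
  Given a Fredholm operator \<open>T\<close>, let \<open>M\<close> be the orthogonal complement of its nullspace and \<open>F\<close> a
  finite-dimensional complement of its range. By the open mapping theorem \<open>(m, v) \<mapsto> T m + v\<close> is an
  isomorphism from \<open>M \<times> F\<close> onto the whole space, and this property is stable under small
  perturbations of \<open>T\<close>. Every Fredholm operator \<open>S\<close> with the property has index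
  \<open>codim M - dim F\<close>, by counting dimensions.
\<close>

subsection \<open>Relative dimension of subspaces\<close>

interpretation complex_vector_pair:
  vector_space_pair "scaleC :: complex \<Rightarrow> 'a \<Rightarrow> 'a::complex_hilbert_space"
    "scaleC :: complex \<Rightarrow> 'b \<Rightarrow> 'b::complex_hilbert_space" ..

abbreviation clinear :: "('a::complex_hilbert_space \<Rightarrow> 'b::complex_hilbert_space) \<Rightarrow> bool" where
  "clinear \<equiv> Vector_Spaces.linear scaleC scaleC"

lemma span_of_subspace: "complex_vector.subspace W \<Longrightarrow> complex_vector.span W = W"
  by simp

lemma mem_span_Un_iff:
  assumes "complex_vector.subspace W"
  shows "x \<in> complex_vector.span (W \<union> B) \<longleftrightarrow> (\<exists>w\<in>W. \<exists>v\<in>complex_vector.span B. x = w + v)"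
  unfolding complex_vector.span_Un span_of_subspace[OF assms] by blast

text \<open>This encodes dim V/W = n by a chain of one-vector extensions from \<open>W\<close> to
  \<open>V\<close>. The count makes sense for infinite-dimensional \<open>W\<close>, which matters
  since \<open>M\<close> below only has finite codimension.\<close>

inductive relative_cdim :: "'a::complex_hilbert_space set \<Rightarrow> 'a set \<Rightarrow> nat \<Rightarrow> bool"
  for W where
  relative_cdim_refl: "complex_vector.subspace W \<Longrightarrow> relative_cdim W W 0"
| relative_cdim_insert: "relative_cdim W V n \<Longrightarrow> x \<notin> V \<Longrightarrow>
    relative_cdim W (complex_vector.span (insert x V)) (Suc n)"

lemma span_insert_span:
  "complex_vector.span (insert x (complex_vector.span S)) = complex_vector.span (insert x S)"
proof
  show "complex_vector.span (insert x (complex_vector.span S)) \<subseteq> complex_vector.span (insert x S)"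
    by (rule complex_vector.span_minimal)
      (auto intro: complex_vector.span_base subsetD[OF complex_vector.span_mono[OF subset_insertI]])
  show "complex_vector.span (insert x S) \<subseteq> complex_vector.span (insert x (complex_vector.span S))"
    by (rule complex_vector.span_mono) (auto intro: complex_vector.span_base)
qed

lemma relative_cdim_subspace:
  "relative_cdim W V n \<Longrightarrow> complex_vector.subspace W \<and> complex_vector.subspace V \<and> W \<subseteq> V"
  by (induction rule: relative_cdim.induct) (auto intro: complex_vector.span_base)

text \<open>Appending the chain from \<open>W\<close> to \<open>V\<close> to the one from
  \<open>U\<close> to \<open>W\<close> adds the lengths.\<close>

lemma relative_cdim_trans:
  assumes "relative_cdim U W m" "relative_cdim W V n"
  shows "relative_cdim U V (m + n)"
  using assms(2)
proof (induction rule: relative_cdim.induct)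
  case relative_cdim_refl
  then show ?case using assms(1) by simp
next
  case (relative_cdim_insert V n x)
  then show ?case using relative_cdim.relative_cdim_insert by fastforce
qed

text \<open>The elements of \<open>B\<close> are adjoined to \<open>W\<close> one at a time;
  independence and the trivial intersection make every extension proper.\<close>

lemma relative_cdim_of_independent:
  assumes "complex_vector.subspace W" "finite B" "complex_vector.independent B"
    and "complex_vector.span B \<inter> W \<subseteq> {0}"
  shows "relative_cdim W (complex_vector.span (W \<union> B)) (card B)"
  using assms(2-)
proof (induction B rule: finite_induct)
  case empty
  then show ?case
    using relative_cdim_refl[OF assms(1)] by (auto simp: span_of_subspace[OF assms(1)])
next
  case (insert b B)
  have mono: "complex_vector.span B \<subseteq> complex_vector.span (insert b B)"
    by (rule complex_vector.span_mono) auto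
  have ind: "complex_vector.independent B" and b: "b \<notin> complex_vector.span B"
    using insert.prems(1) insert.hyps(2) by (auto simp: complex_vector.independent_insert)
  have IH: "relative_cdim W (complex_vector.span (W \<union> B)) (card B)"
    using insert.IH[OF ind] insert.prems(2) mono by blast
  \<comment> \<open>Otherwise b = w + v puts w = b - v into the larger span and into
    \<open>W\<close>, so w = 0 and b depends on \<open>B\<close>.\<close>
  have "b \<notin> complex_vector.span (W \<union> B)"
  proof
    assume "b \<in> complex_vector.span (W \<union> B)"
    then obtain w v where wv: "b = w + v" "w \<in> W" "v \<in> complex_vector.span B"
      using mem_span_Un_iff[OF assms(1)] by auto
    have "w = b - v" using wv by simp
    then have "w \<in> complex_vector.span (insert b B)"
      using wv(3) mono by (simp add: complex_vector.span_base complex_vector.span_diff subsetD)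
    then have "w = 0" using wv insert.prems(2) by blast
    then show False using wv b by simp
  qed
  then have "relative_cdim W (complex_vector.span (insert b (complex_vector.span (W \<union> B)))) (Suc (card B))"
    using IH relative_cdim_insert by blast
  then show ?case using insert.hyps by (simp add: span_insert_span)
qed

text \<open>Elements already in the span are skipped, so \<open>B\<close> may be dependent. This
  supplies the dimension \<open>g\<close> in the index computation before its value is
  known.\<close>

lemma relative_cdim_exists:
  assumes "complex_vector.subspace W" "finite B"
  shows "\<exists>n. relative_cdim W (complex_vector.span (W \<union> B)) n"
  using assms(2)
proof (induction B rule: finite_induct)
  case empty
  then show ?case
    using relative_cdim_refl[OF assms(1)] by (auto simp: span_of_subspace[OF assms(1)])
next
  case (insert b B)
  then obtain n where n: "relative_cdim W (complex_vector.span (W \<union> B)) n" by blast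
  show ?case
  proof (cases "b \<in> complex_vector.span (W \<union> B)")
    case True
    have "complex_vector.span (W \<union> insert b B) = complex_vector.span (W \<union> B)"
      using complex_vector.span_redundant[OF True] by simp
    then show ?thesis using n by (intro exI[of _ n]) simp
  next
    case False
    then show ?thesis using relative_cdim_insert[OF n False] by (auto simp: span_insert_span)
  qed
qed

text \<open>A kernel inside \<open>W\<close> makes V/W isomorphic to f(V)/f(W): if f x = f v with v
  in \<open>V\<close>, then x - v lies in \<open>W\<close>, hence x in \<open>V\<close>, so proper
  extensions stay proper.\<close>

lemma relative_cdim_image:
  assumes f: "clinear f" and ker: "\<And>x. f x = 0 \<Longrightarrow> x \<in> W" and "relative_cdim W V n"
  shows "relative_cdim (f ` W) (f ` V) n"
  using assms(3)
proof (induction rule: relative_cdim.induct)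
  case relative_cdim_refl
  then show ?case
    using complex_vector_pair.linear_subspace_image[OF f] relative_cdim.relative_cdim_refl by blast
next
  case (relative_cdim_insert V n x)
  have "f x \<notin> f ` V"
  proof
    assume "f x \<in> f ` V"
    then obtain v where v: "v \<in> V" "f x = f v" by auto
    then have "x - v \<in> W" using ker complex_vector_pair.linear_diff[OF f, of x v] by simp
    then have "x - v \<in> V" using relative_cdim_subspace[OF relative_cdim_insert.hyps(1)] by blast
    then have "(x - v) + v \<in> V"
      using v(1) relative_cdim_subspace[OF relative_cdim_insert.hyps(1)]
        complex_vector.subspace_add by blast
    then show False using relative_cdim_insert.hyps(2) by simp
  qed
  then show ?case
    using relative_cdim.relative_cdim_insert[OF relative_cdim_insert.IH, of "f x"]
      complex_vector_pair.linear_span_image[OF f, of "insert x V"] by simp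
qed

text \<open>The vectors added along the chain form a basis of a complement of \<open>W\<close> in
  \<open>V\<close>. This is the converse of \<open>relative_cdim_of_independent\<close>.\<close>

lemma relative_cdim_basis:
  assumes "relative_cdim W V n"
  obtains B where "finite B" "card B = n" "complex_vector.independent B"
    "complex_vector.span B \<inter> W \<subseteq> {0}" "V = complex_vector.span (W \<union> B)"
  using assms
proof (induction arbitrary: thesis rule: relative_cdim.induct)
  case relative_cdim_refl
  then show ?case
    using relative_cdim_refl(2)[of "{}"] span_of_subspace[OF relative_cdim_refl(1)]
    by (simp add: complex_vector.independent_empty)
next
  case (relative_cdim_insert V n x)
  obtain B where B: "finite B" "card B = n" "complex_vector.independent B"
    "complex_vector.span B \<inter> W \<subseteq> {0}" "V = complex_vector.span (W \<union> B)"
    using relative_cdim_insert.IH .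
  have BV: "complex_vector.span B \<subseteq> V" unfolding B(5) by (rule complex_vector.span_mono) auto
  have V: "complex_vector.subspace V" "W \<subseteq> V"
    using relative_cdim_subspace[OF relative_cdim_insert.hyps(1)] by auto
  have xB: "x \<notin> complex_vector.span B" using BV relative_cdim_insert.hyps(2) by blast
  have "complex_vector.span (insert x B) \<inter> W \<subseteq> {0}"
  proof
    fix y assume y: "y \<in> complex_vector.span (insert x B) \<inter> W"
    then obtain k where k: "y - k *\<^sub>C x \<in> complex_vector.span B"
      by (auto simp: complex_vector.span_insert)
    have "y - (y - k *\<^sub>C x) \<in> V"
      by (rule complex_vector.subspace_diff[OF V(1)]) (use k y BV V in auto)
    then have kx: "k *\<^sub>C x \<in> V" by simp
    \<comment> \<open>A nonzero coefficient could be inverted, which would put \<open>x\<close> into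
      \<open>V\<close>.\<close>
    have "k = 0"
    proof (rule ccontr)
      assume "k \<noteq> 0"
      then have "x = inverse k *\<^sub>C (k *\<^sub>C x)" by simp
      then have "x \<in> V" using complex_vector.subspace_scale[OF V(1) kx] by metis
      then show False using relative_cdim_insert.hyps(2) by blast
    qed
    then show "y \<in> {0}" using k y B(4) by auto
  qed
  moreover have "complex_vector.independent (insert x B)"
    using xB B(3) by (simp add: complex_vector.independent_insert)
  moreover have "x \<notin> B" using xB complex_vector.span_base by blast
  ultimately show ?case
    using relative_cdim_insert.prems[of "insert x B"] B by (simp add: span_insert_span)
qed

text \<open>Sending each element of a basis of \<open>V\<close> modulo \<open>W\<close> to a representative in the span of \<open>B\<close>
  is injective, so the exchange lemma applies without a basis of \<open>W\<close>.\<close>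
lemma relative_cdim_le_card:
  assumes "relative_cdim W V n" "finite B" "V \<subseteq> complex_vector.span (W \<union> B)"
  shows "n \<le> card B"
proof -
  obtain C where C: "finite C" "card C = n" "complex_vector.independent C"
    "complex_vector.span C \<inter> W \<subseteq> {0}" "V = complex_vector.span (W \<union> C)"
    using relative_cdim_basis[OF assms(1)] .
  have W: "complex_vector.subspace W" using relative_cdim_subspace[OF assms(1)] by blast
  have "\<exists>g\<in>complex_vector.span B. c - g \<in> W" if "c \<in> C" for c
  proof -
    have "c \<in> complex_vector.span (W \<union> B)"
      using that assms(3) C(5) complex_vector.span_base by blast
    then obtain w v where "c = w + v" "w \<in> W" "v \<in> complex_vector.span B"
      using mem_span_Un_iff[OF W] by auto
    then show ?thesis by (intro bexI[of _ v]) auto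
  qed
  then obtain g where g: "\<And>c. c \<in> C \<Longrightarrow> g c \<in> complex_vector.span B \<and> c - g c \<in> W" by metis
  obtain p where p: "clinear p" "\<And>c. c \<in> C \<Longrightarrow> p c = g c"
    using complex_vector_pair.linear_independent_extend[OF C(3), of g] by blast
  have diff: "x - p x \<in> W" if "x \<in> complex_vector.span C" for x
    using that
  proof (induction rule: complex_vector.span_induct_alt)
    case base
    then show ?case using complex_vector.subspace_0[OF W] complex_vector_pair.linear_0[OF p(1)] by simp
  next
    case (step c x y)
    have "c *\<^sub>C (x - p x) + (y - p y) \<in> W"
      using step g p(2) by (auto intro: complex_vector.subspace_add[OF W] complex_vector.subspace_scale[OF W])
    then show ?case
      using complex_vector_pair.linear_add[OF p(1)] complex_vector_pair.linear_scale[OF p(1)]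
      by (simp add: complex_vector.scale_right_diff_distrib algebra_simps)
  qed
  \<comment> \<open>If p x = 0, then x = x - p x lies in \<open>W\<close> as well as in the span of
    \<open>C\<close>, so x = 0.\<close>
  have inj: "inj_on p (complex_vector.span C)"
    using complex_vector_pair.linear_inj_on_iff_eq_0[OF p(1), of "complex_vector.span C"] diff C(4)
    by force
  have "complex_vector.independent (p ` C)"
    using complex_vector_pair.linear_independent_injective_image[OF p(1) C(3) inj] .
  moreover have "p ` C \<subseteq> complex_vector.span B" using p(2) g by auto
  ultimately have "card (p ` C) \<le> card B"
    using complex_vector.independent_span_bound[OF assms(2)] by blast
  moreover have "card (p ` C) = card C"
    by (rule card_image) (rule inj_on_subset[OF inj complex_vector.span_superset])
  ultimately show ?thesis using C(2) by simp
qed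

lemma relative_cdim_unique:
  assumes "relative_cdim W V m" "relative_cdim W V n"
  shows "m = n"
proof -
  have le: "m \<le> n" if "relative_cdim W V m" "relative_cdim W V n" for m n
    using relative_cdim_basis[OF that(2)] relative_cdim_le_card[OF that(1)] by (metis order_refl)
  show ?thesis using le[OF assms] le[OF assms(2,1)] by simp
qed

subsection \<open>Codimension and index\<close>

text \<open>Two representatives of a coset differ by an element of \<open>W\<close>, so the
  existential over representatives collapses to one fixed choice \<open>s\<close>.\<close>

lemma quotient_lincomb_eq:
  assumes W: "complex_vector.subspace W" and X: "X \<subseteq> quotient_space W"
    and s: "\<And>A. A \<in> X \<Longrightarrow> s A \<in> A"
  shows "quotient_lincomb W u X = {y. (\<Sum>A\<in>X. u A *\<^sub>C s A) - y \<in> W}"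
proof -
  have same: "a - b \<in> W" if "A \<in> X" "a \<in> A" "b \<in> A" for A a b
  proof -
    obtain c where "A = {y. c - y \<in> W}"
      using subsetD[OF X \<open>A \<in> X\<close>] unfolding quotient_space_def quotient_def by auto
    then have "c - b \<in> W" "c - a \<in> W" using that(2,3) by auto
    from complex_vector.subspace_diff[OF W this] have "(c - b) - (c - a) \<in> W" .
    then show ?thesis by simp
  qed
  have iff: "(\<Sum>A\<in>X. u A *\<^sub>C t A) - y \<in> W \<longleftrightarrow> (\<Sum>A\<in>X. u A *\<^sub>C s A) - y \<in> W"
    if t: "\<forall>A\<in>X. t A \<in> A" for t y
  proof -
    have "(\<Sum>A\<in>X. u A *\<^sub>C t A) - (\<Sum>A\<in>X. u A *\<^sub>C s A) = (\<Sum>A\<in>X. u A *\<^sub>C (t A - s A))"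
      by (simp add: sum_subtractf complex_vector.scale_right_diff_distrib)
    also have "\<dots> \<in> W"
      using same s t by (intro complex_vector.subspace_sum[OF W] complex_vector.subspace_scale[OF W]) auto
    finally have d: "(\<Sum>A\<in>X. u A *\<^sub>C t A) - (\<Sum>A\<in>X. u A *\<^sub>C s A) \<in> W" .
    show ?thesis
      using complex_vector.subspace_add[OF W d, of "(\<Sum>A\<in>X. u A *\<^sub>C s A) - y"]
        complex_vector.subspace_diff[OF W _ d, of "(\<Sum>A\<in>X. u A *\<^sub>C t A) - y"] by auto
  qed
  show ?thesis unfolding quotient_lincomb_def using iff s by blast
qed

text \<open>Choosing a representative of each coset lifts a basis of H/W to a basis of an algebraic
  complement of \<open>W\<close>.\<close>

lemma finite_quotient_basis_complement:
  assumes W: "complex_vector.subspace W" and X: "finite_quotient_basis W X"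
  obtains F where "finite F" "card F = card X" "complex_vector.independent F"
    "complex_vector.span F \<inter> W \<subseteq> {0}" "complex_vector.span (W \<union> F) = UNIV"
proof -
  have fin: "finite X" and XQ: "X \<subseteq> quotient_space W"
    and ind: "\<And>u. quotient_lincomb W u X = W \<Longrightarrow> \<forall>A\<in>X. u A = 0"
    and spn: "\<And>A. A \<in> quotient_space W \<Longrightarrow> \<exists>u. A = quotient_lincomb W u X"
    using X unfolding finite_quotient_basis_def by auto
  have coset: "\<exists>c. A = {y. c - y \<in> W}" if "A \<in> X" for A
    using subsetD[OF XQ that] unfolding quotient_space_def quotient_def by auto
  have "\<exists>a. a \<in> A" if "A \<in> X" for A
    using coset[OF that] complex_vector.subspace_0[OF W] by (metis (mono_tags) diff_self mem_Collect_eq)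
  then obtain s where s: "\<And>A. A \<in> X \<Longrightarrow> s A \<in> A" by metis
  note lincomb = quotient_lincomb_eq[OF W XQ s]
  have zero: "\<forall>A\<in>X. u A = 0" if "(\<Sum>A\<in>X. u A *\<^sub>C s A) \<in> W" for u
  proof -
    have "{y. (\<Sum>A\<in>X. u A *\<^sub>C s A) - y \<in> W} = W"
      using complex_vector.subspace_diff[OF W that] by force
    then show ?thesis using ind lincomb by metis
  qed
  \<comment> \<open>Cosets sharing a representative coincide. Hence the lift preserves the
    cardinality, and sums over the representatives can be reindexed by \<open>X\<close>.\<close>
  have inj: "inj_on s X"
  proof (rule inj_onI)
    fix A B assume AB: "A \<in> X" "B \<in> X" "s A = s B"
    obtain a b where ab: "A = {y. a - y \<in> W}" "B = {y. b - y \<in> W}"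
      using coset AB by metis
    have "a - s A \<in> W" "b - s A \<in> W" using s[OF AB(1)] s[OF AB(2)] AB(3) ab by auto
    then have d: "a - b \<in> W" using complex_vector.subspace_diff[OF W] by fastforce
    have "a - y \<in> W \<longleftrightarrow> b - y \<in> W" for y
      using complex_vector.subspace_diff[OF W _ d, of "a - y"] complex_vector.subspace_add[OF W _ d, of "b - y"]
      by auto
    then show "A = B" using ab by simp
  qed
  let ?F = "s ` X"
  have sums: "(\<Sum>v\<in>?F. u v *\<^sub>C v) = (\<Sum>A\<in>X. u (s A) *\<^sub>C s A)" for u
    by (simp add: sum.reindex[OF inj])
  have zeroF: "\<forall>v\<in>?F. u v = 0" if "(\<Sum>v\<in>?F. u v *\<^sub>C v) \<in> W" for u
    using zero[of "\<lambda>A. u (s A)"] that by (simp add: sums)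
  have "complex_vector.independent ?F"
    using zeroF complex_vector.subspace_0[OF W] fin
    by (subst complex_vector.dependent_finite) (simp, metis)
  moreover have "complex_vector.span ?F \<inter> W \<subseteq> {0}"
  proof
    fix x assume x: "x \<in> complex_vector.span ?F \<inter> W"
    then obtain u where u: "x = (\<Sum>v\<in>?F. u v *\<^sub>C v)"
      using fin complex_vector.span_finite[of ?F] by auto
    then have "\<forall>v\<in>?F. u v = 0" using zeroF x by blast
    then have "(\<Sum>v\<in>?F. u v *\<^sub>C v) = 0" by (intro sum.neutral) simp
    then show "x \<in> {0}" using u by simp
  qed
  moreover
  have "x \<in> complex_vector.span (W \<union> ?F)" for x
  proof -
    \<comment> \<open>The coset of \<open>x\<close> is a combination of basis cosets, so
      \<open>x\<close> differs from the same combination of representatives by an element of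
      \<open>W\<close>.\<close>
    have "{y. x - y \<in> W} \<in> quotient_space W" unfolding quotient_space_def quotient_def by auto
    then obtain u where "{y. x - y \<in> W} = {y. (\<Sum>A\<in>X. u A *\<^sub>C s A) - y \<in> W}"
      using spn lincomb by metis
    moreover have "x \<in> {y. x - y \<in> W}" using complex_vector.subspace_0[OF W] by simp
    ultimately have "(\<Sum>A\<in>X. u A *\<^sub>C s A) - x \<in> W" by blast
    then have "(\<Sum>A\<in>X. u A *\<^sub>C s A) - ((\<Sum>A\<in>X. u A *\<^sub>C s A) - x) \<in> complex_vector.span (W \<union> ?F)"
      by (intro complex_vector.span_diff complex_vector.span_sum complex_vector.span_scale
          complex_vector.span_base) auto
    then show ?thesis by simp
  qed
  then have "complex_vector.span (W \<union> ?F) = UNIV" by (intro UNIV_eq_I[symmetric])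
  ultimately show thesis by (intro that[of ?F] finite_imageI fin card_image inj)
qed

text \<open>\<open>codim\<close> is the size of the basis that \<open>SOME\<close> picks, so the
  complement is built from that same basis.\<close>

lemma finite_codim_complement:
  assumes "complex_vector.subspace W" "finite_codim W"
  obtains F where "finite F" "card F = codim W" "complex_vector.independent F"
    "complex_vector.span F \<inter> W \<subseteq> {0}" "complex_vector.span (W \<union> F) = UNIV"
proof -
  have "finite_quotient_basis W (SOME X. finite_quotient_basis W X)"
    using assms(2) unfolding finite_codim_def by (rule someI_ex)
  from finite_quotient_basis_complement[OF assms(1) this] show thesis
    using that unfolding codim_def by metis
qed

lemma clinear_blinfun:
  assumes "T \<in> bounded_clinear_ops"
  shows "clinear (blinfun_apply T)"
  using assms unfolding bounded_clinear_ops_def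
  by unfold_locales (auto simp: blinfun.add_right scaleC_add_right scaleC_add_left scaleC_scaleC)

lemma subspace_range:
  assumes "clinear f"
  shows "complex_vector.subspace (range f)"
  using complex_vector_pair.linear_subspace_image[OF assms complex_vector.subspace_UNIV] .

text \<open>Both sides count the codimension of \<open>S(M)\<close> in \<open>H\<close>, once directly and once through \<open>S(H)\<close>.\<close>
lemma fredholm_index_eq:
  fixes S :: "'a::complex_hilbert_space \<Rightarrow>\<^sub>L 'a"
  assumes S: "S \<in> Fred" and M: "complex_vector.subspace M"
    and N: "finite N" "complex_vector.independent N" "complex_vector.span N \<inter> M \<subseteq> {0}"
      "complex_vector.span (M \<union> N) = UNIV"
    and F: "finite F" "complex_vector.independent F"
    and inj: "\<And>x. x \<in> M \<Longrightarrow> blinfun_apply S x \<in> complex_vector.span F \<Longrightarrow> x = 0"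
    and surj: "\<And>y. \<exists>x\<in>M. \<exists>v\<in>complex_vector.span F. y = blinfun_apply S x + v"
  shows "fredholm_index S = int (card N) - int (card F)"
proof -
  have lin: "clinear (blinfun_apply S)" using S clinear_blinfun unfolding Fred_def by blast
  have R: "complex_vector.subspace (range (blinfun_apply S))" using subspace_range[OF lin] .
  have K: "complex_vector.subspace (nullspace S)"
    unfolding nullspace_def using complex_vector_pair.linear_subspace_kernel[OF lin] .
  obtain B where B: "B \<subseteq> nullspace S" "complex_vector.independent B"
    "nullspace S \<subseteq> complex_vector.span B" "card B = complex_vector.dim (nullspace S)"
    using complex_vector.basis_exists[of "nullspace S"] .
  have spanB: "complex_vector.span B = nullspace S"
    using B(1,3) K by (simp add: complex_vector.span_subspace)
  \<comment> \<open>The finite spanning set given by \<open>cfinite_dim\<close> bounds the size of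
    the independent set \<open>B\<close>.\<close>
  have finB: "finite B"
  proof -
    obtain C where "finite C" "complex_vector.span C = nullspace S"
      using S unfolding Fred_def cfinite_dim_def by blast
    then show ?thesis using complex_vector.independent_span_bound[of C B] B by blast
  qed
  have null: "x = 0" if "x \<in> M" "x \<in> nullspace S" for x
    using inj[OF that(1)] that(2) by (simp add: nullspace_def complex_vector.span_zero)
  \<comment> \<open>\<open>?V\<close> is the direct sum of \<open>M\<close> and the nullspace. Its
    codimension \<open>g\<close> links the two counts: card N = n(S) + g and card F = g +
    d(S).\<close>
  let ?V = "complex_vector.span (M \<union> B)"
  have V: "complex_vector.subspace ?V" by simp
  have MB: "relative_cdim M ?V (card B)"
    using relative_cdim_of_independent[OF M finB B(2)] null spanB by blast
  have "complex_vector.span (?V \<union> N) = UNIV"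
  proof -
    have "complex_vector.span (M \<union> N) \<subseteq> complex_vector.span (?V \<union> N)"
      by (rule complex_vector.span_mono) (auto intro: complex_vector.span_base)
    then show ?thesis using N(4) by auto
  qed
  then obtain g where g: "relative_cdim ?V UNIV g"
    using relative_cdim_exists[OF V N(1)] by auto
  have "relative_cdim M UNIV (card N)"
    using relative_cdim_of_independent[OF M N(1-3)] N(4) by simp
  then have 1: "card N = card B + g"
    using relative_cdim_unique[OF relative_cdim_trans[OF MB g]] by simp
  have "x \<in> ?V" if "blinfun_apply S x = 0" for x
    using that spanB complex_vector.span_mono[of B "M \<union> B"] by (auto simp: nullspace_def)
  from relative_cdim_image[OF lin this g]
  have g': "relative_cdim (blinfun_apply S ` ?V) (range (blinfun_apply S)) g" by simp
  \<comment> \<open>The nullspace summand contributes nothing to the image.\<close>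
  have "blinfun_apply S ` ?V = blinfun_apply S ` M"
  proof
    show "blinfun_apply S ` ?V \<subseteq> blinfun_apply S ` M"
    proof safe
      fix x assume "x \<in> ?V"
      then obtain m k where "x = m + k" "m \<in> M" "k \<in> nullspace S"
        using mem_span_Un_iff[OF M] spanB by auto
      then show "blinfun_apply S x \<in> blinfun_apply S ` M"
        by (auto simp: nullspace_def blinfun.add_right)
    qed
  qed (auto intro: complex_vector.span_base)
  then have SM: "relative_cdim (blinfun_apply S ` M) (range (blinfun_apply S)) g" using g' by simp
  obtain G where G: "finite G" "card G = codim (range (blinfun_apply S))" "complex_vector.independent G"
    "complex_vector.span G \<inter> range (blinfun_apply S) \<subseteq> {0}"
    "complex_vector.span (range (blinfun_apply S) \<union> G) = UNIV"
    using finite_codim_complement[OF R] S unfolding Fred_def by blast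
  have "relative_cdim (range (blinfun_apply S)) UNIV (card G)"
    using relative_cdim_of_independent[OF R G(1,3,4)] G(5) by simp
  note total = relative_cdim_trans[OF SM this]
  have SMs: "complex_vector.subspace (blinfun_apply S ` M)"
    using complex_vector_pair.linear_subspace_image[OF lin M] .
  have "complex_vector.span F \<inter> blinfun_apply S ` M \<subseteq> {0}"
    using inj by (fastforce simp: blinfun.zero_right)
  moreover have "complex_vector.span (blinfun_apply S ` M \<union> F) = UNIV"
    using surj mem_span_Un_iff[OF SMs] by blast
  ultimately have "relative_cdim (blinfun_apply S ` M) UNIV (card F)"
    using relative_cdim_of_independent[OF SMs F] by metis
  then have "card F = g + card G" using relative_cdim_unique[OF total] by simp
  then show ?thesis using 1 B(4) G(2) unfolding fredholm_index_def by simp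
qed

subsection \<open>The open mapping theorem\<close>

text \<open>By surjectivity the images of the balls of integer radius cover the Banach space, so by
  Baire the closure of one of them has an interior point.\<close>

lemma closure_image_ball_has_interior:
  fixes f :: "'b::real_normed_vector \<Rightarrow> 'c::banach"
  assumes surj: "f ` E = UNIV"
  obtains a r n where "0 < r" "ball a r \<subseteq> closure (f ` (E \<inter> cball 0 (real n)))"
proof -
  define C where "C n = closure (f ` (E \<inter> cball 0 (real n)))" for n
  have "\<exists>n. interior (C n) \<noteq> {}"
  proof (rule ccontr)
    assume "\<not> ?thesis"
    then have *: "closedin euclidean T \<and> euclidean interior_of T = {}" if "T \<in> range C" for T
      using that by (auto simp: C_def)
    have "(euclidean :: 'c topology) interior_of \<Union>(range C) = {}"
    proof (rule Baire_category_alt)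
      show "completely_metrizable_space (euclidean :: 'c topology) \<or>
          locally_compact_space (euclidean :: 'c topology) \<and> regular_space (euclidean :: 'c topology)"
        using completely_metrizable_space_euclidean by (rule disjI1)
      show "countable (range C)" by (rule countable_image) (rule countableI_type)
    qed (rule *)
    moreover have "y \<in> \<Union>(range C)" for y
    proof -
      have "y \<in> f ` E" unfolding surj by (rule UNIV_I)
      then obtain x where x: "x \<in> E" "y = f x" by (rule imageE)
      obtain n where "norm x \<le> real n" using real_arch_simple by blast
      then have "y \<in> C n" unfolding C_def unfolding x(2)
        by (intro subsetD[OF closure_subset] imageI) (simp add: x(1))
      then show ?thesis by blast
    qed
    then have "\<Union>(range C) = UNIV" by (intro UNIV_eq_I[symmetric])
    ultimately show False by simp
  qed
  then obtain n a where "a \<in> interior (C n)" by blast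
  then obtain r where "0 < r" "ball a r \<subseteq> C n" by (auto simp: mem_interior)
  then show thesis using that C_def by simp
qed

text \<open>Density of an image in a ball around \<open>a\<close> is moved to a ball around 0 by
  taking differences, and then to all \<open>y\<close> by scaling.\<close>

lemma approximate_preimage:
  fixes f :: "'b::real_normed_vector \<Rightarrow> 'c::banach"
  assumes f: "linear f" and E: "subspace E" and surj: "f ` E = UNIV"
  obtains K where "0 \<le> K"
    "\<And>y. \<exists>x\<in>E. norm x \<le> K * norm y \<and> norm (y - f x) \<le> norm y / 2"
proof -
  obtain a r n where r: "0 < r" "ball a r \<subseteq> closure (f ` (E \<inter> cball 0 (real n)))"
    using closure_image_ball_has_interior[OF surj] .
  have step: "\<exists>x\<in>E. norm x \<le> 2 * real n \<and> norm (z - f x) \<le> e"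
    if z: "norm z < r" and e: "0 < e" for z e
  proof -
    have near: "\<exists>x\<in>E. norm x \<le> real n \<and> norm (f x - w) < e / 2" if w: "w \<in> ball a r" for w
    proof -
      have "w \<in> closure (f ` (E \<inter> cball 0 (real n)))" using w r by blast
      then obtain v where v: "v \<in> f ` (E \<inter> cball 0 (real n))" "dist v w < e / 2"
        using e closure_approachable by (metis half_gt_zero)
      then show ?thesis by (auto simp: dist_norm)
    qed
    \<comment> \<open>Subtracting approximate preimages of a + z and a gives one of z: the norm
      bound doubles to 2n, and the errors e/2 add up to e.\<close>
    have "a + z \<in> ball a r" "a \<in> ball a r" using z r(1) by (simp_all add: dist_norm)
    from near[OF this(1)] near[OF this(2)] obtain x1 x2 where
      x: "x1 \<in> E" "norm x1 \<le> real n" "norm (f x1 - (a + z)) < e / 2"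
        "x2 \<in> E" "norm x2 \<le> real n" "norm (f x2 - a) < e / 2"
      by blast
    have "norm (z - f (x1 - x2)) = norm ((f x2 - a) - (f x1 - (a + z)))"
      by (simp add: linear_diff[OF f] algebra_simps)
    also have "\<dots> \<le> norm (f x2 - a) + norm (f x1 - (a + z))" by (rule norm_triangle_ineq4)
    also have "\<dots> \<le> e" using x by simp
    finally show ?thesis
      using x norm_triangle_ineq4[of x1 x2] subspace_diff[OF E]
      by (intro bexI[of _ "x1 - x2"]) auto
  qed
  \<comment> \<open>Scaling \<open>y\<close> to norm r/2 involves the factor c = 2 norm y / r. It
    turns the bound 2n into (4n / r) norm y and the error r/4 into norm y / 2.\<close>
  let ?K = "4 * real n / r"
  have "\<exists>x\<in>E. norm x \<le> ?K * norm y \<and> norm (y - f x) \<le> norm y / 2" for y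
  proof (cases "y = 0")
    case True
    then show ?thesis using subspace_0[OF E] linear_0[OF f] by (intro bexI[of _ 0]) auto
  next
    case False
    define c where "c = 2 * norm y / r"
    have c: "0 < c" using False r(1) by (simp add: c_def)
    have "norm (y /\<^sub>R c) = r / 2" using False r(1) c by (simp add: c_def)
    then obtain x where x: "x \<in> E" "norm x \<le> 2 * real n" "norm (y /\<^sub>R c - f x) \<le> r / 4"
      using step[of "y /\<^sub>R c" "r / 4"] r(1) by auto
    have "norm (c *\<^sub>R x) \<le> c * (2 * real n)" using x(2) c by simp
    then have 1: "norm (c *\<^sub>R x) \<le> ?K * norm y" by (simp add: c_def field_simps)
    have "y - f (c *\<^sub>R x) = c *\<^sub>R (y /\<^sub>R c - f x)"
      using c by (simp add: linear_scale[OF f] scaleR_diff_right)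
    then have "norm (y - f (c *\<^sub>R x)) = c * norm (y /\<^sub>R c - f x)" using c by simp
    also have "\<dots> \<le> c * (r / 4)" using x(3) c by simp
    also have "\<dots> = norm y / 2" using r(1) by (simp add: c_def)
    finally show ?thesis using 1 subspace_scale[OF E x(1)] by blast
  qed
  then show thesis using that[of ?K] r(1) by simp
qed

text \<open>Approximate preimages of the successive errors are summed. The errors halve, so the
  series converges by completeness, and closedness keeps its sum in \<open>E\<close>.\<close>

lemma bounded_preimages:
  fixes f :: "'b::banach \<Rightarrow> 'c::banach"
  assumes f: "bounded_linear f" and E: "subspace E" "closed E" and surj: "f ` E = UNIV"
  obtains K where "0 \<le> K" "\<And>y. \<exists>x\<in>E. f x = y \<and> norm x \<le> K * norm y"
proof -
  interpret f: bounded_linear f by (rule f)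
  obtain K where K: "0 \<le> K"
    "\<And>y. \<exists>x\<in>E. norm x \<le> K * norm y \<and> norm (y - f x) \<le> norm y / 2"
    using approximate_preimage[OF f.linear E(1) surj] by blast
  then obtain g where g: "\<And>y. g y \<in> E" "\<And>y. norm (g y) \<le> K * norm y"
    "\<And>y. norm (y - f (g y)) \<le> norm y / 2" by metis
  have "\<exists>x\<in>E. f x = y \<and> norm x \<le> (2 * K) * norm y" for y
  proof -
    \<comment> \<open>\<open>z k\<close> is the error left after \<open>k\<close>
      corrections.\<close>
    define z where "z k = ((\<lambda>w. w - f (g w)) ^^ k) y" for k
    have z0: "z 0 = y" and zS: "z (Suc k) = z k - f (g (z k))" for k
      by (auto simp: z_def)
    have zn: "norm (z k) \<le> norm y * (1 / 2) ^ k" for k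
    proof (induction k)
      case (Suc k)
      then show ?case using g(3)[of "z k"] by (simp add: zS)
    qed (simp add: z0)
    have gz: "norm (g (z k)) \<le> (K * norm y) * (1 / 2) ^ k" for k
      using g(2)[of "z k"] mult_left_mono[OF zn[of k] K(1)] by (simp add: mult.assoc)
    \<comment> \<open>The geometric series accounts for the factor 2 in the final bound.\<close>
    have sg: "(\<lambda>k. (K * norm y) * (1 / 2) ^ k) sums (2 * K * norm y)"
      using sums_mult[OF geometric_sums[of "1 / 2 :: real"], of "K * norm y"]
      by (simp add: mult.commute mult.left_commute)
    have sm: "summable (\<lambda>k. g (z k))"
      using gz by (intro summable_comparison_test'[OF sums_summable[OF sg]]) auto
    define x where "x = (\<Sum>k. g (z k))"
    have lim: "(\<lambda>n. \<Sum>k<n. g (z k)) \<longlonglongrightarrow> x"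
      unfolding x_def using summable_LIMSEQ[OF sm] .
    have "x \<in> E"
      by (rule closed_sequentially[OF E(2) _ lim]) (auto intro: subspace_sum[OF E(1)] g(1))
    moreover have "f x = y"
    proof -
      \<comment> \<open>Each image f (g (z k)) equals z k - z (k + 1), so the sum
        telescopes.\<close>
      have "f (\<Sum>k<n. g (z k)) = y - z n" for n
        by (induction n) (auto simp: z0 zS f.zero f.add)
      moreover have "z \<longlonglongrightarrow> 0"
        by (rule Lim_null_comparison[of _ "\<lambda>k. norm y * (1 / 2) ^ k"])
          (use zn in \<open>auto intro!: tendsto_eq_intros LIMSEQ_power_zero\<close>)
      ultimately have "(\<lambda>n. f (\<Sum>k<n. g (z k))) \<longlonglongrightarrow> y"
        using tendsto_diff[OF tendsto_const[of y], of z 0] by simp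
      with f.tendsto[OF lim] show ?thesis using LIMSEQ_unique by blast
    qed
    moreover have "norm x \<le> 2 * K * norm y"
      unfolding x_def using norm_suminf_le[OF _ sums_summable[OF sg]] gz sums_unique[OF sg] by metis
    ultimately show ?thesis by blast
  qed
  then show thesis using that[of "2 * K"] K(1) by simp
qed

subsection \<open>Orthogonal complements\<close>

lemma cinner_add_right: "cinner x (y + z) = cinner x y + cinner x z"
  by (subst (1 2 3) cinner_commute) (simp add: cinner_add_left)

lemma cinner_scaleC_right: "cinner x (c *\<^sub>C y) = cnj c * cinner x y"
  by (subst (1 2) cinner_commute) (simp add: cinner_scaleC_left)

lemma cinner_zero_left [simp]: "cinner 0 x = 0"
  using cinner_add_left[of 0 0 x] by simp

lemma cinner_diff_left: "cinner (x - y) z = cinner x z - cinner y z"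
  using cinner_add_left[of "x - y" y z] by simp

lemma cinner_eq_zero_iff [simp]: "cinner x x = 0 \<longleftrightarrow> x = 0"
proof
  assume "cinner x x = 0"
  then have "norm x = 0" using norm_eq_sqrt_cinner[of x] by simp
  then show "x = 0" by simp
qed simp

lemma Re_cinner_polarization: "Re (cinner x y) = ((norm (x + y))\<^sup>2 - (norm (x - y))\<^sup>2) / 4"
proof -
  have sq: "(norm z)\<^sup>2 = Re (cinner z z)" for z :: 'a
    by (simp add: norm_eq_sqrt_cinner[of z] cinner_nonneg)
  have r: "cinner u (x - y) = cinner u x - cinner u y" for u
    using cinner_add_right[of u "x - y" y] by simp
  have c: "Re (cinner y x) = Re (cinner x y)" using cinner_commute[of x y] by simp
  show ?thesis
    by (simp add: sq r c cinner_add_left cinner_add_right cinner_diff_left)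
qed

definition orthogonal_complement :: "'a::complex_hilbert_space set \<Rightarrow> 'a set" where
  "orthogonal_complement S = {x. \<forall>y\<in>S. cinner x y = 0}"

lemma subspace_orthogonal_complement: "complex_vector.subspace (orthogonal_complement S)"
  by (auto simp: complex_vector.subspace_def orthogonal_complement_def cinner_add_left cinner_scaleC_left)

text \<open>Polarization makes the real part of the inner product continuous, and the imaginary part of
  the inner product with \<open>y\<close> is the real part of the one with \<open>\<i> y\<close>.\<close>
lemma closed_orthogonal_complement: "closed (orthogonal_complement S)"
proof -
  have "closed {x :: 'a. cinner x y = 0}" for y
  proof -
    have "{x. cinner x y = 0} = {x. Re (cinner x y) = 0} \<inter> {x. Re (cinner x (\<i> *\<^sub>C y)) = 0}"
      by (auto simp: cinner_scaleC_right complex_eq_iff)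
    also have "closed \<dots>"
      unfolding Re_cinner_polarization
      by (intro closed_Int closed_Collect_eq continuous_intros) simp_all
    finally show ?thesis .
  qed
  moreover have "orthogonal_complement S = (\<Inter>y\<in>S. {x. cinner x y = 0})"
    by (auto simp: orthogonal_complement_def)
  ultimately show ?thesis by (auto intro: closed_INT)
qed

lemma cinner_eq_zero_on_span:
  assumes "x \<in> orthogonal_complement B" "y \<in> complex_vector.span B"
  shows "cinner x y = 0"
  using assms(2)
proof (induction rule: complex_vector.span_induct_alt)
  case base
  show ?case using cinner_commute[of x 0] by simp
next
  case (step c y z)
  then show ?case using assms(1)
    by (simp add: cinner_add_right cinner_scaleC_right orthogonal_complement_def)
qed

lemma span_Int_orthogonal_complement:
  "complex_vector.span B \<inter> orthogonal_complement B \<subseteq> {0}"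
  using cinner_eq_zero_on_span by fastforce

text \<open>One Gram-Schmidt step per element: the projection onto the span of \<open>B\<close> is
  corrected along the part of \<open>b\<close> orthogonal to \<open>B\<close>.\<close>

lemma orthogonal_decomposition:
  assumes "finite B"
  shows "\<exists>v\<in>complex_vector.span B. x - v \<in> orthogonal_complement B"
  using assms
proof (induction B arbitrary: x rule: finite_induct)
  case empty
  then show ?case by (simp add: orthogonal_complement_def)
next
  case (insert b B)
  have mono: "complex_vector.span B \<subseteq> complex_vector.span (insert b B)"
    by (rule complex_vector.span_mono) auto
  obtain v where v: "v \<in> complex_vector.span B" "x - v \<in> orthogonal_complement B"
    using insert.IH by blast
  obtain u where u: "u \<in> complex_vector.span B" "b - u \<in> orthogonal_complement B"
    using insert.IH by blast
  \<comment> \<open>If b = u, the denominator is 0, but then the correction along b - u vanishes and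
    \<open>b\<close> already lies in the span of \<open>B\<close>.\<close>
  define c where "c = cinner (x - v) b / cinner (b - u) b"
  let ?w = "v + c *\<^sub>C (b - u)"
  have 1: "?w \<in> complex_vector.span (insert b B)"
    using u v mono
    by (intro complex_vector.span_add complex_vector.span_scale complex_vector.span_diff)
      (auto intro: complex_vector.span_base)
  have "cinner (x - ?w) b = 0"
  proof (cases "b = u")
    case True
    then show ?thesis using cinner_eq_zero_on_span[OF v(2) u(1)] by simp
  next
    case False
    \<comment> \<open>Since b - u is orthogonal to \<open>u\<close>, the denominator is the squared
      norm of b - u.\<close>
    have "cinner (b - u) b = cinner (b - u) (b - u)"
      using cinner_eq_zero_on_span[OF u(2,1)] cinner_add_right[of "b - u" "b - u" u] by simp
    then have "cinner (b - u) b \<noteq> 0" using False cinner_eq_zero_iff[of "b - u"] by simp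
    moreover have "cinner (x - ?w) b = cinner (x - v) b - c * cinner (b - u) b"
      by (simp add: cinner_diff_left cinner_add_left cinner_scaleC_left algebra_simps)
    ultimately show ?thesis by (simp add: c_def)
  qed
  moreover have "cinner (x - ?w) y = 0" if "y \<in> B" for y
  proof -
    have "cinner (x - ?w) y = cinner (x - v) y - c * cinner (b - u) y"
      by (simp add: cinner_diff_left cinner_add_left cinner_scaleC_left algebra_simps)
    then show ?thesis using that u v by (simp add: orthogonal_complement_def)
  qed
  ultimately show ?case using 1 by (intro bexI[of _ ?w]) (auto simp: orthogonal_complement_def)
qed

text \<open>Orthogonal complements are closed, and the span is its own double complement: for x in
  the double complement, the orthogonal part x - v is orthogonal to itself, hence zero.\<close>

lemma closed_span_finite:
  fixes B :: "'a::complex_hilbert_space set"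
  assumes "finite B"
  shows "closed (complex_vector.span B)"
proof -
  have "complex_vector.span B = orthogonal_complement (orthogonal_complement B)"
  proof
    have "B \<subseteq> orthogonal_complement (orthogonal_complement B)"
    proof -
      have "cinner b y = 0" if "b \<in> B" "y \<in> orthogonal_complement B" for b y
        using that cinner_commute[of b y] by (simp add: orthogonal_complement_def)
      then show ?thesis by (auto simp: orthogonal_complement_def[of "orthogonal_complement B"])
    qed
    then show "complex_vector.span B \<subseteq> orthogonal_complement (orthogonal_complement B)"
      by (rule complex_vector.span_minimal) (rule subspace_orthogonal_complement)
    show "orthogonal_complement (orthogonal_complement B) \<subseteq> complex_vector.span B"
    proof
      fix x assume x: "x \<in> orthogonal_complement (orthogonal_complement B)"
      obtain v where v: "v \<in> complex_vector.span B" "x - v \<in> orthogonal_complement B"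
        using orthogonal_decomposition[OF assms] by blast
      have "v \<in> orthogonal_complement (orthogonal_complement B)"
        using v(1) \<open>complex_vector.span B \<subseteq> _\<close> by blast
      then have "x - v \<in> orthogonal_complement (orthogonal_complement B)"
        using x subspace_orthogonal_complement complex_vector.subspace_diff by blast
      then have "cinner (x - v) (x - v) = 0" using v(2) unfolding orthogonal_complement_def by blast
      then show "x \<in> complex_vector.span B" using v(1) by simp
    qed
  qed
  then show ?thesis using closed_orthogonal_complement by simp
qed

subsection \<open>Local constancy of the index\<close>

text \<open>The open mapping and perturbation arguments run over the real scalars; this makes
  complex subspaces available to them.\<close>

lemma real_subspace:
  assumes "complex_vector.subspace W"
  shows "subspace W"
  using assms unfolding complex_vector.subspace_def subspace_def by (metis scaleC_of_real)

text \<open>The map \<open>(m, v) \<mapsto> T m + v\<close> is an isomorphism of \<open>M \<times> F\<close> onto the space. If \<open>R\<close> is the first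
  component of its inverse, then \<open>S m + v = y\<close> becomes the fixed point equation
  \<open>w = y - (S - T) (R w)\<close> for \<open>w = T m + v\<close>.\<close>
lemma complement_stable:
  fixes T :: "'a::banach \<Rightarrow>\<^sub>L 'a"
  assumes M: "subspace M" "closed M" and F: "subspace F" "closed F"
    and inj: "\<And>x. x \<in> M \<Longrightarrow> blinfun_apply T x \<in> F \<Longrightarrow> x = 0"
    and surj: "\<And>y. \<exists>x\<in>M. \<exists>v\<in>F. y = blinfun_apply T x + v"
  obtains e where "0 < e"
    "\<And>S x. norm (S - T) < e \<Longrightarrow> x \<in> M \<Longrightarrow> blinfun_apply S x \<in> F \<Longrightarrow> x = 0"
    "\<And>S y. norm (S - T) < e \<Longrightarrow> \<exists>x\<in>M. \<exists>v\<in>F. y = blinfun_apply S x + v"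
proof -
  let ?f = "\<lambda>p. blinfun_apply T (fst p) + snd p"
  have "?f ` (M \<times> F) = UNIV"
  proof -
    have "y \<in> ?f ` (M \<times> F)" for y using surj[of y] by force
    then show ?thesis by blast
  qed
  moreover have "bounded_linear ?f"
    by (intro bounded_linear_intros)
  ultimately obtain K where K: "0 \<le> K" "\<And>y. \<exists>p\<in>M \<times> F. ?f p = y \<and> norm p \<le> K * norm y"
    using bounded_preimages[of ?f "M \<times> F"] subspace_Times[OF M(1) F(1)] closed_Times[OF M(2) F(2)]
    by blast
  then obtain R where R: "\<And>y. R y \<in> M \<times> F" "\<And>y. ?f (R y) = y" "\<And>y. norm (R y) \<le> K * norm y"
    by metis
  have uniq: "m = m'" if "m \<in> M" "m' \<in> M" "v \<in> F" "v' \<in> F"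
    "blinfun_apply T m + v = blinfun_apply T m' + v'" for m m' v v'
  proof -
    have "blinfun_apply T (m - m') = v' - v" using that(5) by (simp add: blinfun.diff_right algebra_simps)
    then have "m - m' = 0"
      using inj[of "m - m'"] that subspace_diff[OF M(1)] subspace_diff[OF F(1)] by simp
    then show ?thesis by simp
  qed
  \<comment> \<open>\<open>R\<close> is only a pointwise choice, but uniqueness of the decomposition
    makes its first component respect differences.\<close>
  have Rdiff: "fst (R a) - fst (R b) = fst (R (a - b))" for a b
  proof (rule uniq)
    show "fst (R a) - fst (R b) \<in> M" "snd (R a) - snd (R b) \<in> F" "fst (R (a - b)) \<in> M" "snd (R (a - b)) \<in> F"
      using R(1)[of a] R(1)[of b] R(1)[of "a - b"] subspace_diff[OF M(1)] subspace_diff[OF F(1)]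
      by (auto simp: mem_Times_iff)
    show "blinfun_apply T (fst (R a) - fst (R b)) + (snd (R a) - snd (R b)) =
        blinfun_apply T (fst (R (a - b))) + snd (R (a - b))"
      using R(2)[of a] R(2)[of b] R(2)[of "a - b"] by (simp add: blinfun.diff_right algebra_simps)
  qed
  have Rfst: "norm (fst (R y)) \<le> K * norm y" for y
    using R(3)[of y] norm_fst_le[of "fst (R y)" "snd (R y)"] by simp
  \<comment> \<open>The summand 1 keeps the denominator positive when K = 0; e K \<le> 1/2 yields a
    contraction with factor 1/2.\<close>
  define e where "e = 1 / (2 * (K + 1))"
  have e: "0 < e" "e * K \<le> 1 / 2" using K(1) by (auto simp: e_def field_simps)
  have contr: "norm (blinfun_apply (S - T) (fst (R z))) \<le> 1 / 2 * norm z" if S: "norm (S - T) < e" for S z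
  proof -
    have "norm (blinfun_apply (S - T) (fst (R z))) \<le> norm (S - T) * norm (fst (R z))"
      by (rule norm_blinfun)
    also have "\<dots> \<le> e * (K * norm z)"
      using S Rfst[of z] e(1) by (intro mult_mono) auto
    also have "\<dots> \<le> 1 / 2 * norm z"
      using mult_right_mono[OF e(2), of "norm z"] by (simp add: mult.assoc)
    finally show ?thesis .
  qed
  have 1: "x = 0" if S: "norm (S - T) < e" and x: "x \<in> M" "blinfun_apply S x \<in> F" for S x
  proof -
    \<comment> \<open>Since x is in \<open>M\<close> and -S x in \<open>F\<close>, the first
      component of \<open>R z\<close> is x. As (S - T) x = -z, the contraction gives norm z \<le>
      norm z / 2, so T x = S x lies in \<open>F\<close>.\<close>
    define z where "z = blinfun_apply T x - blinfun_apply S x"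
    have "fst (R z) = x"
    proof (rule uniq)
      show "fst (R z) \<in> M" "snd (R z) \<in> F" "x \<in> M" "- blinfun_apply S x \<in> F"
        using R(1)[of z] x subspace_neg[OF F(1)] by (auto simp: mem_Times_iff)
      show "blinfun_apply T (fst (R z)) + snd (R z) = blinfun_apply T x + - blinfun_apply S x"
        using R(2)[of z] by (simp add: z_def)
    qed
    then have "norm (blinfun_apply (S - T) x) \<le> 1 / 2 * norm z" using contr[OF S, of z] by simp
    moreover have "norm (blinfun_apply (S - T) x) = norm z"
      by (simp add: z_def blinfun.diff_left norm_minus_commute)
    ultimately have "z = 0" by simp
    then show "x = 0" using inj[OF x(1)] x(2) by (simp add: z_def)
  qed
  have 2: "\<exists>x\<in>M. \<exists>v\<in>F. y = blinfun_apply S x + v" if S: "norm (S - T) < e" for S y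
  proof -
    let ?g = "\<lambda>w. y - blinfun_apply (S - T) (fst (R w))"
    have "dist (?g a) (?g b) \<le> 1 / 2 * dist a b" for a b
    proof -
      have "?g a - ?g b = blinfun_apply (S - T) (fst (R (b - a)))"
        unfolding Rdiff[symmetric] by (simp add: blinfun.diff_right)
      then show ?thesis using contr[OF S, of "b - a"] by (simp add: dist_norm norm_minus_commute)
    qed
    then obtain w where w: "?g w = w" using banach_fix_type[of "1 / 2" ?g] by auto
    have "y = w + blinfun_apply (S - T) (fst (R w))" using w by (simp add: algebra_simps)
    also have "\<dots> = blinfun_apply S (fst (R w)) + snd (R w)"
      by (subst (1) R(2)[of w, symmetric]) (simp add: blinfun.diff_left)
    finally show ?thesis using R(1)[of w] by (auto simp: mem_Times_iff)
  qed
  show thesis using that[OF e(1) 1 2] .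
qed

text \<open>\<open>N\<close>, \<open>M\<close> and \<open>F\<close> are chosen from \<open>T\<close>
  alone and serve every nearby \<open>S\<close> in \<open>Fred\<close>, so both indices equal card N
  - card F.\<close>

lemma fredholm_index_locally_constant:
  fixes T :: "'a::complex_hilbert_space \<Rightarrow>\<^sub>L 'a"
  assumes T: "T \<in> Fred"
  shows "\<exists>e>0. \<forall>S\<in>Fred. dist S T < e \<longrightarrow> fredholm_index S = fredholm_index T"
proof -
  have lin: "clinear (blinfun_apply T)" using T clinear_blinfun unfolding Fred_def by blast
  obtain C where C: "finite C" "complex_vector.span C = nullspace T"
    using T unfolding Fred_def cfinite_dim_def by blast
  obtain N where N: "N \<subseteq> nullspace T" "complex_vector.independent N" "nullspace T \<subseteq> complex_vector.span N"
    using complex_vector.basis_exists[of "nullspace T"] by metis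
  have finN: "finite N" using complex_vector.independent_span_bound[of C N] C N by blast
  have null: "complex_vector.span N = nullspace T"
    using N complex_vector.span_minimal[OF N(1)] C(2) complex_vector.subspace_span[of C] by auto
  define M where "M = orthogonal_complement N"
  have M: "complex_vector.subspace M" "closed M" "complex_vector.span N \<inter> M \<subseteq> {0}"
    unfolding M_def
    by (rule subspace_orthogonal_complement closed_orthogonal_complement span_Int_orthogonal_complement)+
  have decomp: "\<exists>m\<in>M. \<exists>v\<in>complex_vector.span N. x = m + v" for x
  proof -
    obtain v where "v \<in> complex_vector.span N" "x - v \<in> M"
      using orthogonal_decomposition[OF finN, of x] unfolding M_def by blast
    then show ?thesis by (intro bexI[of _ "x - v"] bexI[of _ v]) auto
  qed
  have "x \<in> complex_vector.span (M \<union> N)" for x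
    unfolding mem_span_Un_iff[OF M(1)] by (rule decomp)
  then have MN: "complex_vector.span (M \<union> N) = UNIV" by (intro UNIV_eq_I[symmetric])
  have R: "complex_vector.subspace (range (blinfun_apply T))" using subspace_range[OF lin] .
  have "finite_codim (range (blinfun_apply T))" using T unfolding Fred_def by blast
  from finite_codim_complement[OF R this] obtain F where F:
    "finite F" "card F = codim (range (blinfun_apply T))" "complex_vector.independent F"
    "complex_vector.span F \<inter> range (blinfun_apply T) \<subseteq> {0}"
    "complex_vector.span (range (blinfun_apply T) \<union> F) = UNIV"
    .
  have inj: "x = 0" if "x \<in> M" "blinfun_apply T x \<in> complex_vector.span F" for x
  proof -
    have "x \<in> nullspace T" using that(2) F(4) unfolding nullspace_def by blast
    then show ?thesis using that(1) M(3) null by blast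
  qed
  have surj: "\<exists>x\<in>M. \<exists>v\<in>complex_vector.span F. y = blinfun_apply T x + v" for y
  proof -
    obtain x v where x: "v \<in> complex_vector.span F" "y = blinfun_apply T x + v"
      using mem_span_Un_iff[OF R, of y F] unfolding F(5) by auto
    \<comment> \<open>\<open>T\<close> kills the nullspace component of \<open>x\<close>, so the
      component in \<open>M\<close> has the same image.\<close>
    obtain m k where m: "m \<in> M" "k \<in> complex_vector.span N" "x = m + k" using decomp[of x] by blast
    then have "blinfun_apply T x = blinfun_apply T m"
      using null by (auto simp: nullspace_def blinfun.add_right)
    then show ?thesis using x m(1) by auto
  qed
  note index = fredholm_index_eq[OF _ M(1) finN N(2) M(3) MN F(1,3)]
  obtain e where e: "0 < e"
    "\<And>S x. norm (S - T) < e \<Longrightarrow> x \<in> M \<Longrightarrow> blinfun_apply S x \<in> complex_vector.span F \<Longrightarrow> x = 0"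
    "\<And>S y. norm (S - T) < e \<Longrightarrow> \<exists>x\<in>M. \<exists>v\<in>complex_vector.span F. y = blinfun_apply S x + v"
    using complement_stable[OF real_subspace[OF M(1)] M(2)
        real_subspace[OF complex_vector.subspace_span] closed_span_finite[OF F(1)] inj surj] by metis
  have "fredholm_index S = fredholm_index T" if S: "S \<in> Fred" "norm (S - T) < e" for S
    using index[OF S(1) e(2)[OF S(2)] e(3)[OF S(2)]] index[OF T inj surj] by simp
  then show ?thesis using e(1) unfolding dist_norm by blast
qed

text \<open>Local constancy is continuity into the discrete topology, the form in which it composes
  with the family.\<close>

lemma continuous_map_fredholm_index:
  "continuous_map (top_of_set (Fred :: ('a::complex_hilbert_space \<Rightarrow>\<^sub>L 'a) set))
    (discrete_topology UNIV) fredholm_index"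
  unfolding continuous_map_def
proof (intro conjI allI impI)
  fix U :: "int set"
  let ?F = "Fred :: ('a \<Rightarrow>\<^sub>L 'a) set"
  show "openin (top_of_set ?F) {T \<in> topspace (top_of_set ?F). fredholm_index T \<in> U}"
    unfolding openin_euclidean_subtopology_iff
  proof (intro conjI ballI)
    fix T :: "'a \<Rightarrow>\<^sub>L 'a" assume T: "T \<in> {T \<in> topspace (top_of_set ?F). fredholm_index T \<in> U}"
    then have TF: "T \<in> Fred" "fredholm_index T \<in> U" by simp_all
    obtain e where e: "0 < e" "\<forall>S\<in>Fred. dist S T < e \<longrightarrow> fredholm_index S = fredholm_index T"
      using fredholm_index_locally_constant[OF TF(1)] by blast
    show "\<exists>e>0. \<forall>S\<in>?F. dist S T < e \<longrightarrow>
        S \<in> {T \<in> topspace (top_of_set ?F). fredholm_index T \<in> U}"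
    proof (intro exI conjI ballI impI)
      show "0 < e" by (rule e(1))
      fix S :: "'a \<Rightarrow>\<^sub>L 'a" assume S: "S \<in> Fred" "dist S T < e"
      then have "fredholm_index S = fredholm_index T" using e(2) by blast
      then show "S \<in> {T \<in> topspace (top_of_set ?F). fredholm_index T \<in> U}"
        using S(1) TF(2) by simp
    qed
  qed auto
qed auto

theorem theorem2p2:
  fixes X :: "'x topology"
    and \<T> :: "'x \<Rightarrow> 'h::complex_hilbert_space \<Rightarrow>\<^sub>L 'h"
  assumes infinite_dimensional: "\<not> cfinite_dim (UNIV :: 'h set)"
    and separable: "separable_space (euclidean :: 'h topology)"
    and countably_many_components: "countable (connected_components_of X)"
    and continuous_family: "continuous_map X (top_of_set Fred) \<T>"
  shows "(\<forall>x\<in>topspace X. \<forall>y\<in>topspace X.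
            connected_component_of_set X x = connected_component_of_set X y \<longrightarrow>
            fredholm_index (\<T> x) = fredholm_index (\<T> y)) \<and>
         (\<exists>!i. is_family_index X \<T> i) \<and>
         is_family_index X \<T> (family_index X \<T>) \<and>
         (\<forall>x\<^sub>0. topspace X = {x\<^sub>0} \<longrightarrow>
            connected_components_of X = {{x\<^sub>0}} \<and>
            family_index X \<T> {x\<^sub>0} = fredholm_index (\<T> x\<^sub>0))"
proof -
  let ?C = "connected_component_of_set X"
  have const: "fredholm_index (\<T> x) = fredholm_index (\<T> y)"
    if "x \<in> topspace X" "y \<in> topspace X" "?C x = ?C y" for x y
  proof -
    have "continuous_map X (discrete_topology UNIV) (fredholm_index \<circ> \<T>)"
      using continuous_map_compose[OF continuous_family continuous_map_fredholm_index] .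
    \<comment> \<open>A connected subset of a discrete space has at most one point.\<close>
    then have "connectedin (discrete_topology UNIV) ((fredholm_index \<circ> \<T>) ` ?C x)"
      by (rule connectedin_continuous_map_image) (rule connectedin_connected_component_of)
    then obtain a where "(fredholm_index \<circ> \<T>) ` ?C x \<subseteq> {a}"
      by (auto simp: connectedin_discrete_topology)
    moreover have "x \<in> ?C x" "y \<in> ?C x"
      using that connected_component_of_refl[of X] by auto
    ultimately show ?thesis by auto
  qed
  \<comment> \<open>Each component takes its value at an arbitrary representative; the restriction
    makes \<open>i\<close> extensional, as \<open>is_family_index\<close> demands.\<close>
  define i where "i = (\<lambda>c\<in>connected_components_of X.
    fredholm_index (\<T> (SOME x. x \<in> topspace X \<and> ?C x = c)))"
  have component: "?C x \<in> connected_components_of X" if "x \<in> topspace X" for x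
    using that by (simp add: connected_components_of_def)
  have "i (?C x) = fredholm_index (\<T> x)" if x: "x \<in> topspace X" for x
  proof -
    let ?y = "SOME y. y \<in> topspace X \<and> ?C y = ?C x"
    have "?y \<in> topspace X \<and> ?C ?y = ?C x" by (rule someI[of _ x]) (simp add: x)
    then have y: "?y \<in> topspace X" "?C ?y = ?C x" by blast+
    have "i (?C x) = fredholm_index (\<T> ?y)"
      unfolding i_def using component[OF x] by (rule restrict_apply')
    also have "\<dots> = fredholm_index (\<T> x)" using const[OF y(1) x y(2)] .
    finally show ?thesis .
  qed
  then have i: "is_family_index X \<T> i" unfolding is_family_index_def by (simp add: i_def)
  \<comment> \<open>Every component is that of some point, which fixes the values there;
    extensionality fixes them elsewhere.\<close>
  have unique: "j = i" if j: "is_family_index X \<T> j" for j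
  proof (rule PiE_ext)
    show "j \<in> connected_components_of X \<rightarrow>\<^sub>E UNIV" using j unfolding is_family_index_def by blast
    show "i \<in> connected_components_of X \<rightarrow>\<^sub>E UNIV" using i unfolding is_family_index_def by blast
    fix c assume "c \<in> connected_components_of X"
    then obtain x where "x \<in> topspace X" "c = ?C x" by (auto simp: connected_components_of_def)
    then show "j c = i c" using i j unfolding is_family_index_def by simp
  qed
  have ex1: "\<exists>!i. is_family_index X \<T> i" using i unique by (rule ex1I)
  then have fam: "is_family_index X \<T> (family_index X \<T>)"
    unfolding family_index_def by (rule theI')
  moreover have "connected_components_of X = {{x\<^sub>0}} \<and> family_index X \<T> {x\<^sub>0} = fredholm_index (\<T> x\<^sub>0)"
    if x\<^sub>0: "topspace X = {x\<^sub>0}" for x\<^sub>0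
  proof -
    have "?C x\<^sub>0 = {x\<^sub>0}"
      using connected_component_of_subset_topspace[of X x\<^sub>0] connected_component_of_refl[of X x\<^sub>0] x\<^sub>0
      by auto
    then show ?thesis
      using fam x\<^sub>0 by (auto simp: connected_components_of_def is_family_index_def)
  qed
  ultimately show ?thesis using const ex1 by blast
qed

end
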